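(* Let $(T,h)$ be a compact orientable Riemannian manifold of dimension $p$, $(M,\varphi)$ a Riemannian manifold of dimension $n$, and $X^{(i)}_{(\alpha)}(t^\gamma,x^k)$ a d-tensor field on $J^1(T,M)$ not depending on $x^m_\mu$. Then the $C^2$ solutions of the first-order PDE system $$\frac{\partial x^i}{\partial t^\alpha}=X^{(i)}_{(\alpha)}(t^\gamma,x^k(t^\gamma))$$ are harmonic maps of the multi-time dependent spray $(H,G)$ on $J^1(T,M)$ with temporal components $$H^{(i)}_{(\alpha)\beta}=-\tfrac12 H^\gamma_{\alpha\beta}x^i_\gamma$$ and local spatial components $$G^{(i)}_{(\alpha)\beta}=\tfrac12\gamma^i_{jk}x^j_\alpha x^k_\beta+h_{\alpha\beta}F^i,$$ where $$F^i=-\frac{h^{\mu\nu}}{2p}\left\{\varphi^{il}X^{(s)}_{(\nu)\Vert l}\varphi_{sr}\left[X^{(r)}_{(\mu)}-x^r_\mu\right]+X^{(i)}_{(\nu)\Vert m}x^m_\mu+X^{(i)}_{(\nu)//\mu}\right\}.$$ In other words, every $C^2$ solution satisfies, for all $i=1,\dots,n$, the harmonic map equations $$h^{\alpha\beta}\left\{x^i_{\alpha\beta}+2H^{(i)}_{(\alpha)\beta}+2G^{(i)}_{(\alpha)\beta}\right\}=0 .$$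
   Context: $T$, $M$ are smooth connected manifolds with local coordinates $(t^\alpha)_{\alpha=1,\dots,p}$ and $(x^i)_{i=1,\dots,n}$; $J^1(T,M)$ has local coordinates $(t^\alpha,x^i,x^i_\alpha)$. Summation over repeated indices is understood. Along a map $x(t)$, $x^i_\alpha=\partial x^i/\partial t^\alpha$ and $x^i_{\alpha\beta}=\partial^2x^i/\partial t^\alpha\partial t^\beta$. $H^\gamma_{\alpha\beta}$ and $\gamma^i_{jk}$ are the Christoffel symbols of $h_{\alpha\beta}(t)$ and $\varphi_{ij}(x)$; $h^{\alpha\beta}$, $\varphi^{ij}$ are the inverse metrics. A d-tensor $X^{(i)}_{(\alpha)}$ is a family of smooth local components transforming like those of a vertical vector field $X^{(i)}_{(\alpha)}\partial/\partial x^i_\alpha$. Its covariant derivatives are $$X^{(i)}_{(\alpha)//\beta}=\frac{\partial X^{(i)}_{(\alpha)}}{\partial t^\beta}-X^{(i)}_{(\mu)}H^\mu_{\alpha\beta},\qquad X^{(i)}_{(\alpha)\Vert j}=\frac{\partial X^{(i)}_{(\alpha)}}{\partial x^j}+X^{(m)}_{(\alpha)}\gamma^i_{mj}.$$ A "harmonic map of the spray $(H,G)$" means a map $x(t)$ satisfying the last displayed equations of the claim. *)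

theory Defs
  imports "HOL-Analysis.Analysis"
begin

subsection \<open>Differentiability classes on open sets\<close>

text \<open>Intended for an open set \<open>S\<close> of a finite-dimensional space, where this is the usual class
  \<open>C\<^sup>k\<close>: all iterated directional derivatives up to order \<open>k\<close> exist and are continuous.\<close>

primrec Ck_on :: "nat \<Rightarrow> ('a::real_normed_vector \<Rightarrow> 'b::real_normed_vector) \<Rightarrow> 'a set \<Rightarrow> bool" where
  "Ck_on 0 f S \<longleftrightarrow> continuous_on S f"
| "Ck_on (Suc k) f S \<longleftrightarrow> (\<forall>x\<in>S. f differentiable (at x)) \<and>
     (\<forall>v. Ck_on k (\<lambda>x. frechet_derivative f (at x) v) S)"

definition smooth_on :: "('a::real_normed_vector \<Rightarrow> 'b::real_normed_vector) \<Rightarrow> 'a set \<Rightarrow> bool" where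
  "smooth_on f S \<longleftrightarrow> (\<forall>k. Ck_on k f S)"

definition partial :: "'n \<Rightarrow> (real^'n \<Rightarrow> real) \<Rightarrow> real^'n \<Rightarrow> real" where
  "partial j f x = frechet_derivative f (at x) (axis j 1)"


subsection \<open>Smooth manifolds\<close>

text \<open>A chart is a pair of a coordinate domain and a coordinate map; the values of the map outside
  the domain are irrelevant.\<close>

type_synonym ('a, 'n) chart = "'a set \<times> ('a \<Rightarrow> real^'n)"

abbreviation chart_dom :: "('a, 'n) chart \<Rightarrow> 'a set" where
  "chart_dom \<equiv> fst"

abbreviation chart_map :: "('a, 'n) chart \<Rightarrow> 'a \<Rightarrow> real^'n" where
  "chart_map \<equiv> snd"

definition chart_img :: "('a, 'n) chart \<Rightarrow> (real^'n) set" where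
  "chart_img c = chart_map c ` chart_dom c"

definition chart_inv :: "('a, 'n) chart \<Rightarrow> real^'n \<Rightarrow> 'a" where
  "chart_inv c = inv_into (chart_dom c) (chart_map c)"

definition is_chart :: "'a topology \<Rightarrow> ('a, 'n::finite) chart \<Rightarrow> bool" where
  "is_chart X c \<longleftrightarrow> openin X (chart_dom c) \<and> open (chart_img c) \<and>
     homeomorphic_map (subtopology X (chart_dom c)) (top_of_set (chart_img c)) (chart_map c)"

definition overlap :: "('a, 'n) chart \<Rightarrow> ('a, 'n) chart \<Rightarrow> (real^'n) set" where
  "overlap c d = chart_map c ` (chart_dom c \<inter> chart_dom d)"

definition transition :: "('a, 'n) chart \<Rightarrow> ('a, 'n) chart \<Rightarrow> real^'n \<Rightarrow> real^'n" where
  "transition c d = chart_map d \<circ> chart_inv c"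

definition smoothly_compatible :: "('a, 'n::finite) chart \<Rightarrow> ('a, 'n) chart \<Rightarrow> bool" where
  "smoothly_compatible c d \<longleftrightarrow>
     smooth_on (transition c d) (overlap c d) \<and> smooth_on (transition d c) (overlap d c)"

text \<open>A smooth manifold (without boundary) of dimension \<open>CARD('n)\<close>, given by its topology and its
  maximal smooth atlas.\<close>

definition smooth_manifold :: "'a topology \<Rightarrow> ('a, 'n::finite) chart set \<Rightarrow> bool" where
  "smooth_manifold X A \<longleftrightarrow>
     Hausdorff_space X \<and> second_countable X \<and>
     (\<forall>c\<in>A. is_chart X c) \<and> (\<Union>c\<in>A. chart_dom c) = topspace X \<and>
     (\<forall>c\<in>A. \<forall>d\<in>A. smoothly_compatible c d) \<and>
     (\<forall>c. is_chart X c \<and> (\<forall>d\<in>A. smoothly_compatible c d) \<longrightarrow> c \<in> A)"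

definition orientable_manifold :: "'a topology \<Rightarrow> ('a, 'n::finite) chart set \<Rightarrow> bool" where
  "orientable_manifold X A \<longleftrightarrow>
     (\<exists>B\<subseteq>A. (\<Union>c\<in>B. chart_dom c) = topspace X \<and>
       (\<forall>c\<in>B. \<forall>d\<in>B. \<forall>t\<in>overlap c d. det (jacobian (transition c d) (at t)) > 0))"


subsection \<open>Tensor fields in local components\<close>

text \<open>\<open>g c t $ i $ j\<close> is the component \<open>g\<^sub>i\<^sub>j\<close> at the point with coordinates \<open>t\<close> in the chart \<open>c\<close>.\<close>

definition riemannian_metric ::
  "('a, 'n::finite) chart set \<Rightarrow> (('a, 'n) chart \<Rightarrow> real^'n \<Rightarrow> real^'n^'n) \<Rightarrow> bool" where
  "riemannian_metric A g \<longleftrightarrow>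
     (\<forall>c\<in>A. smooth_on (g c) (chart_img c)) \<and>
     (\<forall>c\<in>A. \<forall>t\<in>chart_img c. transpose (g c t) = g c t \<and> (\<forall>u. u \<noteq> 0 \<longrightarrow> u \<bullet> (g c t *v u) > 0)) \<and>
     (\<forall>c\<in>A. \<forall>d\<in>A. \<forall>t\<in>overlap c d.
        let J = jacobian (transition c d) (at t)
        in g c t = transpose J ** g d (transition c d t) ** J)"

text \<open>The coordinates \<open>x\<^sup>i\<^sub>\<alpha>\<close> on the fibres of \<open>J\<^sup>1(T,M)\<close>, and components with the same index pair,
  are matrices \<open>v\<close> with \<open>v $ i $ \<alpha>\<close> for \<open>x\<^sup>i\<^sub>\<alpha>\<close>. Under a change of charts from \<open>(cT, cM)\<close> to
  \<open>(dT, dM)\<close>, both the fibre coordinates and the components of a vertical vector field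
  \<open>Y\<^sup>(\<^sup>i\<^sup>)\<^sub>(\<^sub>\<alpha>\<^sub>) \<partial>/\<partial>x\<^sup>i\<^sub>\<alpha>\<close> at \<open>(t, x)\<close> are multiplied by
  \<open>(\<partial>x'\<^sup>i/\<partial>x\<^sup>j) (\<partial>t\<^sup>\<beta>/\<partial>t'\<^sup>\<alpha>)\<close>.\<close>

definition vertical_change ::
  "('a, 'p::finite) chart \<Rightarrow> ('a, 'p) chart \<Rightarrow> ('b, 'n::finite) chart \<Rightarrow> ('b, 'n) chart \<Rightarrow>
   real^'p \<Rightarrow> real^'n \<Rightarrow> real^'p^'n \<Rightarrow> real^'p^'n" where
  "vertical_change cT dT cM dM t x v =
     jacobian (transition cM dM) (at x) ** v ** jacobian (transition dT cT) (at (transition cT dT t))"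

text \<open>d-tensor fields of the type \<open>Y\<^sup>(\<^sup>i\<^sup>)\<^sub>(\<^sub>\<alpha>\<^sub>)(t, x, v)\<close> on \<open>J\<^sup>1(T,M)\<close>, whose components may in
  general depend on the fibre coordinates \<open>v\<close>.\<close>

definition vertical_d_tensor ::
  "('a, 'p::finite) chart set \<Rightarrow> ('b, 'n::finite) chart set \<Rightarrow>
   (('a, 'p) chart \<Rightarrow> ('b, 'n) chart \<Rightarrow> real^'p \<Rightarrow> real^'n \<Rightarrow> real^'p^'n \<Rightarrow> real^'p^'n) \<Rightarrow> bool" where
  "vertical_d_tensor AT AM Y \<longleftrightarrow>
     (\<forall>cT\<in>AT. \<forall>cM\<in>AM.
        smooth_on (\<lambda>(t, x, v). Y cT cM t x v) (chart_img cT \<times> chart_img cM \<times> UNIV)) \<and>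
     (\<forall>cT\<in>AT. \<forall>dT\<in>AT. \<forall>cM\<in>AM. \<forall>dM\<in>AM. \<forall>t\<in>overlap cT dT. \<forall>x\<in>overlap cM dM. \<forall>v.
        Y dT dM (transition cT dT t) (transition cM dM x) (vertical_change cT dT cM dM t x v) =
        vertical_change cT dT cM dM t x (Y cT cM t x v))"


subsection \<open>Christoffel symbols and covariant derivatives in local coordinates\<close>

text \<open>\<open>christoffel g x i j k\<close> has the upper index \<open>i\<close> and the lower indices \<open>j\<close>, \<open>k\<close>.\<close>

definition christoffel :: "(real^'n::finite \<Rightarrow> real^'n^'n) \<Rightarrow> real^'n \<Rightarrow> 'n \<Rightarrow> 'n \<Rightarrow> 'n \<Rightarrow> real" where
  "christoffel g x i j k =
     1/2 * (\<Sum>l\<in>UNIV. matrix_inv (g x) $ i $ l *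
       (partial j (\<lambda>y. g y $ l $ k) x + partial k (\<lambda>y. g y $ l $ j) x
        - partial l (\<lambda>y. g y $ j $ k) x))"

text \<open>\<open>X\<^sup>(\<^sup>i\<^sup>)\<^sub>(\<^sub>\<alpha>\<^sub>)\<^sub>/\<^sub>/\<^sub>\<beta>\<close>\<close>

definition cov_deriv_T ::
  "(real^'p::finite \<Rightarrow> real^'p^'p) \<Rightarrow> (real^'p \<Rightarrow> real^'n::finite \<Rightarrow> real^'p^'n) \<Rightarrow>
   real^'p \<Rightarrow> real^'n \<Rightarrow> 'n \<Rightarrow> 'p \<Rightarrow> 'p \<Rightarrow> real" where
  "cov_deriv_T h X t x i \<alpha> \<beta> =
     partial \<beta> (\<lambda>s. X s x $ i $ \<alpha>) t - (\<Sum>\<mu>\<in>UNIV. X t x $ i $ \<mu> * christoffel h t \<mu> \<alpha> \<beta>)"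

text \<open>\<open>X\<^sup>(\<^sup>i\<^sup>)\<^sub>(\<^sub>\<alpha>\<^sub>)\<^sub>\<parallel>\<^sub>j\<close>\<close>

definition cov_deriv_M ::
  "(real^'n::finite \<Rightarrow> real^'n^'n) \<Rightarrow> (real^'p::finite \<Rightarrow> real^'n \<Rightarrow> real^'p^'n) \<Rightarrow>
   real^'p \<Rightarrow> real^'n \<Rightarrow> 'n \<Rightarrow> 'p \<Rightarrow> 'n \<Rightarrow> real" where
  "cov_deriv_M \<phi> X t x i \<alpha> j =
     partial j (\<lambda>y. X t y $ i $ \<alpha>) x + (\<Sum>m\<in>UNIV. X t x $ m $ \<alpha> * christoffel \<phi> x i m j)"


subsection \<open>Multi-time dependent sprays and their harmonic maps\<close>

text \<open>Local components \<open>S\<^sup>(\<^sup>i\<^sup>)\<^sub>(\<^sub>\<alpha>\<^sub>)\<^sub>\<beta>(t, x, v)\<close> on \<open>J\<^sup>1(T,M)\<close>, written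
  \<open>S cT cM t x v i \<alpha> \<beta>\<close>.\<close>

type_synonym ('a, 'p, 'b, 'n) spray_components =
  "('a, 'p) chart \<Rightarrow> ('b, 'n) chart \<Rightarrow> real^'p \<Rightarrow> real^'n \<Rightarrow> real^'p^'n \<Rightarrow> 'n \<Rightarrow> 'p \<Rightarrow> 'p \<Rightarrow> real"

definition temporal_spray ::
  "(('a, 'p::finite) chart \<Rightarrow> real^'p \<Rightarrow> real^'p^'p) \<Rightarrow> ('a, 'p, 'b, 'n::finite) spray_components" where
  "temporal_spray h cT cM t x v i \<alpha> \<beta> =
     - 1/2 * (\<Sum>\<gamma>\<in>UNIV. christoffel (h cT) t \<gamma> \<alpha> \<beta> * v $ i $ \<gamma>)"

definition F_term ::
  "(real^'p::finite \<Rightarrow> real^'p^'p) \<Rightarrow> (real^'n::finite \<Rightarrow> real^'n^'n) \<Rightarrow>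
   (real^'p \<Rightarrow> real^'n \<Rightarrow> real^'p^'n) \<Rightarrow> real^'p \<Rightarrow> real^'n \<Rightarrow> real^'p^'n \<Rightarrow> 'n \<Rightarrow> real" where
  "F_term h \<phi> X t x v i =
     - (\<Sum>\<mu>\<in>UNIV. \<Sum>\<nu>\<in>UNIV. matrix_inv (h t) $ \<mu> $ \<nu> / (2 * real CARD('p)) *
         ((\<Sum>l\<in>UNIV. \<Sum>s\<in>UNIV. \<Sum>r\<in>UNIV.
             matrix_inv (\<phi> x) $ i $ l * cov_deriv_M \<phi> X t x s \<nu> l * \<phi> x $ s $ r *
             (X t x $ r $ \<mu> - v $ r $ \<mu>))
          + (\<Sum>m\<in>UNIV. cov_deriv_M \<phi> X t x i \<nu> m * v $ m $ \<mu>)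
          + cov_deriv_T h X t x i \<nu> \<mu>))"

definition spatial_spray ::
  "(('a, 'p::finite) chart \<Rightarrow> real^'p \<Rightarrow> real^'p^'p) \<Rightarrow>
   (('b, 'n::finite) chart \<Rightarrow> real^'n \<Rightarrow> real^'n^'n) \<Rightarrow>
   (('a, 'p) chart \<Rightarrow> ('b, 'n) chart \<Rightarrow> real^'p \<Rightarrow> real^'n \<Rightarrow> real^'p^'n) \<Rightarrow>
   ('a, 'p, 'b, 'n) spray_components" where
  "spatial_spray h \<phi> X cT cM t x v i \<alpha> \<beta> =
     1/2 * (\<Sum>j\<in>UNIV. \<Sum>k\<in>UNIV. christoffel (\<phi> cM) x i j k * v $ j $ \<alpha> * v $ k $ \<beta>)
     + h cT t $ \<alpha> $ \<beta> * F_term (h cT) (\<phi> cM) (X cT cM) t x v i"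

text \<open>The coordinate expression \<open>x(t)\<close> of a map, on the open set of coordinates \<open>t\<close> where it makes
  sense.\<close>

definition local_dom ::
  "('a, 'p) chart \<Rightarrow> ('b, 'n) chart \<Rightarrow> ('a \<Rightarrow> 'b) \<Rightarrow> (real^'p) set" where
  "local_dom cT cM f = chart_map cT ` (chart_dom cT \<inter> f -` chart_dom cM)"

definition local_rep ::
  "('a, 'p) chart \<Rightarrow> ('b, 'n) chart \<Rightarrow> ('a \<Rightarrow> 'b) \<Rightarrow> real^'p \<Rightarrow> real^'n" where
  "local_rep cT cM f = chart_map cM \<circ> f \<circ> chart_inv cT"

definition Ck_map ::
  "nat \<Rightarrow> 'a topology \<Rightarrow> ('a, 'p::finite) chart set \<Rightarrow> 'b topology \<Rightarrow> ('b, 'n::finite) chart set \<Rightarrow>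
   ('a \<Rightarrow> 'b) \<Rightarrow> bool" where
  "Ck_map k T AT M AM f \<longleftrightarrow> continuous_map T M f \<and>
     (\<forall>cT\<in>AT. \<forall>cM\<in>AM. Ck_on k (local_rep cT cM f) (local_dom cT cM f))"

definition jet :: "(real^'p::finite \<Rightarrow> real^'n::finite) \<Rightarrow> real^'p \<Rightarrow> real^'p^'n" where
  "jet y t = (\<chi> i \<alpha>. partial \<alpha> (\<lambda>s. y s $ i) t)"

definition solves_first_order_system ::
  "('a, 'p::finite) chart set \<Rightarrow> ('b, 'n::finite) chart set \<Rightarrow>
   (('a, 'p) chart \<Rightarrow> ('b, 'n) chart \<Rightarrow> real^'p \<Rightarrow> real^'n \<Rightarrow> real^'p^'n) \<Rightarrow> ('a \<Rightarrow> 'b) \<Rightarrow> bool" where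
  "solves_first_order_system AT AM X f \<longleftrightarrow>
     (\<forall>cT\<in>AT. \<forall>cM\<in>AM. \<forall>t\<in>local_dom cT cM f. \<forall>i \<alpha>.
        partial \<alpha> (\<lambda>s. local_rep cT cM f s $ i) t = X cT cM t (local_rep cT cM f t) $ i $ \<alpha>)"

definition harmonic_map_of_spray ::
  "('a, 'p::finite) chart set \<Rightarrow> ('b, 'n::finite) chart set \<Rightarrow>
   (('a, 'p) chart \<Rightarrow> real^'p \<Rightarrow> real^'p^'p) \<Rightarrow>
   ('a, 'p, 'b, 'n) spray_components \<Rightarrow> ('a, 'p, 'b, 'n) spray_components \<Rightarrow> ('a \<Rightarrow> 'b) \<Rightarrow> bool" where
  "harmonic_map_of_spray AT AM h H G f \<longleftrightarrow>
     (\<forall>cT\<in>AT. \<forall>cM\<in>AM. \<forall>t\<in>local_dom cT cM f. \<forall>i.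
        let y = local_rep cT cM f; v = jet y t in
        (\<Sum>\<alpha>\<in>UNIV. \<Sum>\<beta>\<in>UNIV. matrix_inv (h cT t) $ \<alpha> $ \<beta> *
           (partial \<alpha> (partial \<beta> (\<lambda>s. y s $ i)) t
            + 2 * H cT cM t (y t) v i \<alpha> \<beta> + 2 * G cT cM t (y t) v i \<alpha> \<beta>)) = 0)"

end

theory Submission
  imports Defs
begin

text \<open>In coordinates, differentiating $x^i_\beta = X^{(i)}_{(\beta)}(t, x(t))$ gives
  $x^i_{\alpha\beta} = \partial_\alpha X^{(i)}_{(\beta)} + x^m_\alpha\,\partial_m X^{(i)}_{(\beta)}$.
  Along a solution the bracket $X^{(r)}_{(\mu)} - x^r_\mu$ vanishes, and since
  $h^{\alpha\beta} h_{\alpha\beta} = p$, the contribution of $h_{\alpha\beta} F^i$ is minus the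
  $h$-trace of $X^{(i)}_{(\nu)\Vert m} x^m_\mu + X^{(i)}_{(\nu)//\mu}$. Its Christoffel terms cancel
  those of the spray because $h^{\alpha\beta}$ is symmetric.\<close>

lemma is_chart_inj_on: "is_chart X c \<Longrightarrow> inj_on (chart_map c) (chart_dom c)"
  using openin_subset[of X "chart_dom c"]
  unfolding is_chart_def homeomorphic_eq_everything_map
  by (auto simp: topspace_subtopology inf.absorb2)

text \<open>The first-order system is to be differentiated at a point, so it must hold on a whole
  neighbourhood of that point. The preimage of the target domain is open by continuity of
  \<open>f\<close>, and the chart, as a homeomorphism onto an open image, carries it to an open set
  of coordinates.\<close>

lemma open_local_dom:
  assumes "is_chart T cT" and "is_chart M cM" and "continuous_map T M f"
  shows "open (local_dom cT cM f)"
proof -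
  let ?U = "{a \<in> topspace T. f a \<in> chart_dom cM}"
  have "openin T ?U"
    using assms(2,3) by (auto simp: is_chart_def intro: openin_continuous_map_preimage)
  then have "openin (subtopology T (chart_dom cT)) (chart_dom cT \<inter> ?U)"
    by (rule openin_subtopology_Int2)
  moreover have "chart_dom cT \<inter> ?U = chart_dom cT \<inter> f -` chart_dom cM"
    using assms(1) openin_subset[of T "chart_dom cT"] by (auto simp: is_chart_def)
  moreover have "open_map (subtopology T (chart_dom cT)) (top_of_set (chart_img cT)) (chart_map cT)"
    using assms(1) by (simp add: is_chart_def homeomorphic_imp_open_map)
  ultimately have "openin (top_of_set (chart_img cT)) (local_dom cT cM f)"
    unfolding open_map_def local_dom_def by fastforce
  then show ?thesis
    using assms(1) by (auto simp: is_chart_def dest: openin_open_trans)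
qed

lemma local_dom_subset_chart_img: "local_dom cT cM f \<subseteq> chart_img cT"
  by (auto simp: local_dom_def chart_img_def)

lemma local_rep_in_chart_img:
  assumes "is_chart T cT" and "t \<in> local_dom cT cM f"
  shows "local_rep cT cM f t \<in> chart_img cM"
  using assms is_chart_inj_on[OF assms(1)]
  by (auto simp: local_dom_def local_rep_def chart_inv_def chart_img_def)

lemma smooth_on_differentiable_at: "smooth_on f S \<Longrightarrow> x \<in> S \<Longrightarrow> f differentiable (at x)"
  unfolding smooth_on_def by (metis Ck_on.simps(2))

lemma partial_eq: "(f has_derivative f') (at x) \<Longrightarrow> partial j f x = f' (axis j 1)"
  by (simp add: partial_def frechet_derivative_at[symmetric])

text \<open>\<open>frechet_derivative\<close> is a choice among all derivatives at the point.
  Functions that agree near the point have the same derivatives there, so the choice is the same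
  even if there is none; hence no differentiability is assumed.\<close>

lemma partial_cong_open:
  assumes "open S" and "x \<in> S" and "\<And>y. y \<in> S \<Longrightarrow> f y = g y"
  shows "partial j f x = partial j g x"
proof -
  have "(f has_derivative D) (at x) \<longleftrightarrow> (g has_derivative D) (at x)" for D
    using assms by (auto elim: has_derivative_transform_within_open)
  then show ?thesis by (simp add: partial_def frechet_derivative_def)
qed

lemma linear_axis_expansion:
  fixes D :: "real^'n::finite \<Rightarrow> real"
  assumes "linear D"
  shows "D w = (\<Sum>m\<in>UNIV. D (axis m 1) * w $ m)"
proof -
  have "D w = D (\<Sum>m\<in>UNIV. w $ m *\<^sub>R axis m 1)"
    using basis_expansion[of w] by (simp add: scalar_mult_eq_scaleR)
  also have "\<dots> = (\<Sum>m\<in>UNIV. D (axis m 1) * w $ m)"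
    by (simp add: linear_sum[OF assms] linear_scale[OF assms] mult.commute)
  finally show ?thesis .
qed

text \<open>The total derivative along s \<mapsto> (s, y s) is \<open>D\<close> at the pair
  (\<open>axis \<alpha> 1\<close>, \<open>E (axis \<alpha> 1)\<close>). Linearity splits it into the
  explicit dependence on s, with y frozen, and the dependence through y, which expands along the
  coordinate axes.\<close>

lemma partial_chain_pair:
  fixes \<Phi> :: "(real^'p::finite) \<times> (real^'n::finite) \<Rightarrow> real" and y :: "real^'p \<Rightarrow> real^'n"
  assumes \<Phi>: "\<Phi> differentiable (at (t, y t))" and y: "y differentiable (at t)"
  shows "partial \<alpha> (\<lambda>s. \<Phi> (s, y s)) t =
    partial \<alpha> (\<lambda>s. \<Phi> (s, y t)) t + (\<Sum>m\<in>UNIV. partial m (\<lambda>z. \<Phi> (t, z)) (y t) * jet y t $ m $ \<alpha>)"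
proof -
  obtain D where D: "(\<Phi> has_derivative D) (at (t, y t))"
    using \<Phi> by (auto simp: differentiable_def)
  obtain E where E: "(y has_derivative E) (at t)"
    using y by (auto simp: differentiable_def)
  have lin: "linear D" using D by (rule has_derivative_linear)
  have total: "((\<lambda>s. \<Phi> (s, y s)) has_derivative (\<lambda>w. D (w, E w))) (at t)"
    by (rule has_derivative_compose[where g = \<Phi> and f = "\<lambda>s. (s, y s)"])
      (auto intro!: derivative_eq_intros E D)
  have left: "((\<lambda>s. \<Phi> (s, y t)) has_derivative (\<lambda>w. D (w, 0))) (at t)"
    by (rule has_derivative_compose[where g = \<Phi> and f = "\<lambda>s. (s, y t)"])
      (auto intro!: derivative_eq_intros D)
  have right: "((\<lambda>z. \<Phi> (t, z)) has_derivative (\<lambda>w. D (0, w))) (at (y t))"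
    by (rule has_derivative_compose[where g = \<Phi> and f = "\<lambda>z. (t, z)"])
      (auto intro!: derivative_eq_intros D)
  have jet: "jet y t $ m $ \<alpha> = E (axis \<alpha> 1) $ m" for m
  proof -
    have "((\<lambda>s. y s $ m) has_derivative (\<lambda>w. E w $ m)) (at t)"
      using E by (rule bounded_linear.has_derivative[OF bounded_linear_vec_nth])
    then show ?thesis by (simp add: jet_def partial_eq)
  qed
  have "partial \<alpha> (\<lambda>s. \<Phi> (s, y s)) t = D (axis \<alpha> 1, E (axis \<alpha> 1))"
    by (rule partial_eq[OF total])
  also have "\<dots> = D (axis \<alpha> 1, 0) + D (0, E (axis \<alpha> 1))"
    using linear_add[OF lin, of "(axis \<alpha> 1, 0)" "(0, E (axis \<alpha> 1))"] by simp
  also have "D (0, E (axis \<alpha> 1)) = (\<Sum>m\<in>UNIV. D (0, axis m 1) * E (axis \<alpha> 1) $ m)"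
    by (rule linear_axis_expansion) (rule has_derivative_linear[OF right])
  finally show ?thesis
    by (simp add: partial_eq[OF left] partial_eq[OF right] jet)
qed

lemma pos_def_invertible:
  fixes A :: "real^'n::finite^'n"
  assumes "\<And>u. u \<noteq> 0 \<Longrightarrow> u \<bullet> (A *v u) > 0"
  shows "invertible A"
  unfolding invertible_left_inverse matrix_left_invertible_ker
  using assms by (metis inner_zero_right less_irrefl)

lemma matrix_inv_inverse:
  fixes A :: "real^'n::finite^'n"
  assumes "invertible A"
  shows "matrix_inv A ** A = mat 1" and "A ** matrix_inv A = mat 1"
  using someI_ex[OF assms[unfolded invertible_def]] by (simp_all add: matrix_inv_def)

text \<open>The transpose of an inverse inverts the transpose, which is \<open>A\<close> itself;
  inverses are unique.\<close>

lemma matrix_inv_symmetric: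
  fixes A :: "real^'n::finite^'n"
  assumes "invertible A" and "transpose A = A"
  shows "transpose (matrix_inv A) = matrix_inv A"
  using assms
  by (metis matrix_inv_inverse matrix_mul_assoc matrix_mul_lid matrix_mul_rid matrix_transpose_mul
      transpose_mat)

text \<open>By symmetry of \<open>A\<close> the sum is the trace of
  \<open>matrix_inv A ** A\<close>, the identity. For the metric \<open>h\<close> this produces the
  factor p that cancels the denominator p in \<open>F_term\<close>.\<close>

lemma sum_matrix_inv_mult_entries:
  fixes A :: "real^'n::finite^'n"
  assumes "invertible A" and "transpose A = A"
  shows "(\<Sum>i\<in>UNIV. \<Sum>j\<in>UNIV. matrix_inv A $ i $ j * A $ i $ j) = real CARD('n)"
proof -
  have sym: "A $ i $ j = A $ j $ i" for i j
    using assms(2) by (metis transpose_def vec_lambda_beta)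
  have "matrix_inv A ** A = mat 1"
    by (rule matrix_inv_inverse(1)[OF assms(1)])
  moreover have "(\<Sum>j\<in>UNIV. matrix_inv A $ i $ j * A $ i $ j) = (matrix_inv A ** A) $ i $ i" for i
    by (simp add: matrix_matrix_mult_def sym[of i])
  ultimately show ?thesis
    by (simp add: mat_def)
qed

text \<open>Reindexing by the symmetry of $h^{\mu\nu}$ replaces the symmetry of the Christoffel symbols in
  their lower indices.\<close>

lemma sum_symmetric_swap:
  fixes A :: "real^'n::finite^'n"
  assumes "transpose A = A"
  shows "(\<Sum>i\<in>UNIV. \<Sum>j\<in>UNIV. A $ i $ j * a j i) = (\<Sum>i\<in>UNIV. \<Sum>j\<in>UNIV. A $ i $ j * a i j)"
proof -
  have "A $ i $ j = A $ j $ i" for i j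
    using assms by (metis transpose_def vec_lambda_beta)
  then show ?thesis by (subst sum.swap) simp
qed

lemma F_term_on_solution:
  "F_term h \<phi> X t x (X t x) i =
    - (\<Sum>\<mu>\<in>UNIV. \<Sum>\<nu>\<in>UNIV. matrix_inv (h t) $ \<mu> $ \<nu> *
        ((\<Sum>m\<in>UNIV. cov_deriv_M \<phi> X t x i \<nu> m * X t x $ m $ \<mu>) + cov_deriv_T h X t x i \<nu> \<mu>))
      / (2 * real CARD('p))"
  for h :: "real^'p::finite \<Rightarrow> real^'p^'p"
  by (simp add: F_term_def sum_divide_distrib)

text \<open>The algebraic core, at a single point: \<open>x2\<close> stands for the second
  derivatives of a solution, already expressed through X by the chain rule, and the fibre
  coordinates have been replaced by X.\<close>

lemma harmonic_equation_on_solution: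
  fixes h :: "('a, 'p::finite) chart \<Rightarrow> real^'p \<Rightarrow> real^'p^'p"
    and \<phi> :: "('b, 'n::finite) chart \<Rightarrow> real^'n \<Rightarrow> real^'n^'n"
  assumes inv: "invertible (h cT t)" and sym: "transpose (h cT t) = h cT t"
    and x2: "\<And>\<alpha> \<beta>. x2 \<alpha> \<beta> = partial \<alpha> (\<lambda>s. X cT cM s x $ i $ \<beta>) t +
      (\<Sum>m\<in>UNIV. partial m (\<lambda>z. X cT cM t z $ i $ \<beta>) x * X cT cM t x $ m $ \<alpha>)"
  shows "(\<Sum>\<alpha>\<in>UNIV. \<Sum>\<beta>\<in>UNIV. matrix_inv (h cT t) $ \<alpha> $ \<beta> *
    (x2 \<alpha> \<beta> + 2 * temporal_spray h cT cM t x (X cT cM t x) i \<alpha> \<beta>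
      + 2 * spatial_spray h \<phi> X cT cM t x (X cT cM t x) i \<alpha> \<beta>)) = 0"
proof -
  let ?g = "matrix_inv (h cT t)" and ?X = "X cT cM t x"
  define \<Gamma> where "\<Gamma> \<alpha> \<beta> = (\<Sum>\<gamma>\<in>UNIV. christoffel (h cT) t \<gamma> \<alpha> \<beta> * ?X $ i $ \<gamma>)" for \<alpha> \<beta>
  define C where "C \<alpha> \<beta> = (\<Sum>j\<in>UNIV. \<Sum>k\<in>UNIV. christoffel (\<phi> cM) x i j k * ?X $ j $ \<alpha> * ?X $ k $ \<beta>)"
    for \<alpha> \<beta>
  define F where "F = F_term (h cT) (\<phi> cM) (X cT cM) t x ?X i"
  \<comment> \<open>Treating the contraction with the inverse metric as a linear functional that
    ignores transposition reduces the claim to an identity between a few numbers.\<close>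
  define tr where "tr a = (\<Sum>\<alpha>\<in>UNIV. \<Sum>\<beta>\<in>UNIV. ?g $ \<alpha> $ \<beta> * a \<alpha> \<beta>)" for a :: "'p \<Rightarrow> 'p \<Rightarrow> real"
  have tr_add: "tr (\<lambda>\<alpha> \<beta>. a \<alpha> \<beta> + b \<alpha> \<beta>) = tr a + tr b"
    and tr_diff: "tr (\<lambda>\<alpha> \<beta>. a \<alpha> \<beta> - b \<alpha> \<beta>) = tr a - tr b"
    and tr_scale: "tr (\<lambda>\<alpha> \<beta>. a \<alpha> \<beta> * c) = tr a * c" for a b c
    by (simp_all add: tr_def sum.distrib sum_subtractf algebra_simps sum_distrib_left)
  have swap: "tr (\<lambda>\<alpha> \<beta>. a \<beta> \<alpha>) = tr a" for a
    unfolding tr_def by (rule sum_symmetric_swap) (rule matrix_inv_symmetric[OF inv sym])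
  have trace: "tr (\<lambda>\<alpha> \<beta>. h cT t $ \<alpha> $ \<beta>) = real CARD('p)"
    unfolding tr_def by (rule sum_matrix_inv_mult_entries[OF inv sym])
  \<comment> \<open>Here \<beta> is the index of the tensor and \<alpha> that of the
    differentiation, so \<open>C\<close> and \<open>\<Gamma>\<close> come out with their arguments
    in the order opposite to that in the spray; \<open>swap\<close> repairs this under
    \<open>tr\<close>.\<close>
  have cov: "(\<Sum>m\<in>UNIV. cov_deriv_M (\<phi> cM) (X cT cM) t x i \<beta> m * ?X $ m $ \<alpha>)
      + cov_deriv_T (h cT) (X cT cM) t x i \<beta> \<alpha> = x2 \<alpha> \<beta> + C \<beta> \<alpha> - \<Gamma> \<beta> \<alpha>" for \<alpha> \<beta>
  proof -
    have "C \<beta> \<alpha> = (\<Sum>m\<in>UNIV. \<Sum>s\<in>UNIV. ?X $ s $ \<beta> * christoffel (\<phi> cM) x i s m * ?X $ m $ \<alpha>)"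
      unfolding C_def by (subst sum.swap) (simp add: mult_ac)
    moreover have "\<Gamma> \<beta> \<alpha> = (\<Sum>\<mu>\<in>UNIV. ?X $ i $ \<mu> * christoffel (h cT) t \<mu> \<beta> \<alpha>)"
      by (simp add: \<Gamma>_def mult.commute)
    ultimately show ?thesis
      by (simp add: cov_deriv_M_def cov_deriv_T_def x2 sum.distrib distrib_right
          sum_distrib_right)
  qed
  have "F = - tr (\<lambda>\<alpha> \<beta>. x2 \<alpha> \<beta> + C \<beta> \<alpha> - \<Gamma> \<beta> \<alpha>) / (2 * real CARD('p))"
    unfolding F_def F_term_on_solution cov tr_def by simp
  then have F: "2 * real CARD('p) * F = - (tr x2 + tr C - tr \<Gamma>)"
    by (simp add: tr_add tr_diff swap[of C] swap[of \<Gamma>])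
  have "tr (\<lambda>\<alpha> \<beta>. x2 \<alpha> \<beta> + 2 * temporal_spray h cT cM t x ?X i \<alpha> \<beta>
      + 2 * spatial_spray h \<phi> X cT cM t x ?X i \<alpha> \<beta>) =
    tr (\<lambda>\<alpha> \<beta>. x2 \<alpha> \<beta> - \<Gamma> \<alpha> \<beta> + C \<alpha> \<beta> + h cT t $ \<alpha> $ \<beta> * (2 * F))"
    by (simp add: temporal_spray_def spatial_spray_def \<Gamma>_def C_def F_def algebra_simps)
  also have "\<dots> = tr x2 - tr \<Gamma> + tr C + real CARD('p) * (2 * F)"
    by (simp only: tr_add tr_diff tr_scale trace)
  also have "\<dots> = 0" using F by simp
  finally show ?thesis unfolding tr_def .
qed

theorem theorem1p3:
  fixes T :: "'a topology" and AT :: "('a, 'p::finite) chart set"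
    and M :: "'b topology" and AM :: "('b, 'n::finite) chart set"
    and h :: "('a, 'p) chart \<Rightarrow> real^'p \<Rightarrow> real^'p^'p"
    and \<phi> :: "('b, 'n) chart \<Rightarrow> real^'n \<Rightarrow> real^'n^'n"
    and X :: "('a, 'p) chart \<Rightarrow> ('b, 'n) chart \<Rightarrow> real^'p \<Rightarrow> real^'n \<Rightarrow> real^'p^'n"
    and f :: "'a \<Rightarrow> 'b"
  assumes "smooth_manifold T AT" and "connected_space T"
    and "compact_space T" and "orientable_manifold T AT"
    and "riemannian_metric AT h"
    and "smooth_manifold M AM" and "connected_space M"
    and "riemannian_metric AM \<phi>"
    and "vertical_d_tensor AT AM (\<lambda>cT cM t x v. X cT cM t x)"
    and "Ck_map 2 T AT M AM f"
    and "solves_first_order_system AT AM X f"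
  shows "harmonic_map_of_spray AT AM h (temporal_spray h) (spatial_spray h \<phi> X) f"
  unfolding harmonic_map_of_spray_def Let_def
proof (intro ballI allI)
  fix cT cM t i
  assume cT: "cT \<in> AT" and cM: "cM \<in> AM" and t: "t \<in> local_dom cT cM f"
  define y where "y = local_rep cT cM f"
  let ?U = "local_dom cT cM f"
  have chT: "is_chart T cT" and chM: "is_chart M cM"
    using assms(1,6) cT cM by (auto simp: smooth_manifold_def)
  have openU: "open ?U"
    using open_local_dom[OF chT chM] assms(10) by (simp add: Ck_map_def)
  have tT: "t \<in> chart_img cT" using t local_dom_subset_chart_img by blast
  have yM: "y t \<in> chart_img cM"
    unfolding y_def by (rule local_rep_in_chart_img[OF chT t])
  have ydiff: "y differentiable (at t)"
    using assms(10) cT cM t by (auto simp: Ck_map_def y_def numeral_2_eq_2)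
  have sol: "partial \<beta> (\<lambda>s. y s $ j) s = X cT cM s (y s) $ j $ \<beta>" if "s \<in> ?U" for s j \<beta>
    using assms(11) cT cM that unfolding solves_first_order_system_def y_def by blast
  have jet: "jet y t = X cT cM t (y t)"
    by (simp add: jet_def vec_eq_iff sol[OF t])
  have Xdiff: "(\<lambda>z. X cT cM (fst z) (snd z) $ i $ \<beta>) differentiable (at (t, y t))" for \<beta>
  proof -
    \<comment> \<open>Smoothness of the d-tensor is stated on the jet space. Since X is constant in
      the fibre coordinate, any value serves as base point; 0 is taken, and the result is pulled
      back along the inclusion (t, x) \<mapsto> (t, x, 0).\<close>
    have "(\<lambda>(t, x, v). X cT cM t x) differentiable (at (t, y t, 0 :: real^'p^'n))"
      using assms(9) cT cM tT yM
      by (auto simp: vertical_d_tensor_def intro: smooth_on_differentiable_at)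
    then obtain D where
      D: "((\<lambda>(t, x, v). X cT cM t x) has_derivative D) (at (t, y t, 0 :: real^'p^'n))"
      by (auto simp: differentiable_def)
    have "((\<lambda>z. (fst z, snd z, 0 :: real^'p^'n)) has_derivative (\<lambda>w. (fst w, snd w, 0)))
        (at (t, y t))"
      by (auto intro!: derivative_eq_intros)
    from has_derivative_compose[OF this, of "\<lambda>(t, x, v). X cT cM t x" D] D
    have "((\<lambda>z. X cT cM (fst z) (snd z)) has_derivative (\<lambda>w. D (fst w, snd w, 0))) (at (t, y t))"
      by simp
    then have "((\<lambda>z. X cT cM (fst z) (snd z) $ i $ \<beta>) has_derivative
        (\<lambda>w. D (fst w, snd w, 0) $ i $ \<beta>)) (at (t, y t))"
      by (intro bounded_linear.has_derivative[OF bounded_linear_vec_nth])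
    then show ?thesis by (auto simp: differentiable_def)
  qed
  have x2: "partial \<alpha> (partial \<beta> (\<lambda>s. y s $ i)) t = partial \<alpha> (\<lambda>s. X cT cM s (y t) $ i $ \<beta>) t +
      (\<Sum>m\<in>UNIV. partial m (\<lambda>z. X cT cM t z $ i $ \<beta>) (y t) * X cT cM t (y t) $ m $ \<alpha>)" for \<alpha> \<beta>
  proof -
    \<comment> \<open>The inner derivative equals X along y on all of the open set
      \<open>?U\<close>, so the outer derivative may be taken of X instead.\<close>
    have "partial \<alpha> (partial \<beta> (\<lambda>s. y s $ i)) t = partial \<alpha> (\<lambda>s. X cT cM s (y s) $ i $ \<beta>) t"
      by (rule partial_cong_open[OF openU t]) (rule sol)
    also note partial_chain_pair[OF Xdiff ydiff, unfolded fst_conv snd_conv jet]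
    finally show ?thesis .
  qed
  have sym: "transpose (h cT t) = h cT t" and inv: "invertible (h cT t)"
    using assms(5) cT tT by (auto simp: riemannian_metric_def intro: pos_def_invertible)
  show "(\<Sum>\<alpha>\<in>UNIV. \<Sum>\<beta>\<in>UNIV. matrix_inv (h cT t) $ \<alpha> $ \<beta> *
      (partial \<alpha> (partial \<beta> (\<lambda>s. local_rep cT cM f s $ i)) t
        + 2 * temporal_spray h cT cM t (local_rep cT cM f t) (jet (local_rep cT cM f) t) i \<alpha> \<beta>
        + 2 * spatial_spray h \<phi> X cT cM t (local_rep cT cM f t) (jet (local_rep cT cM f) t) i \<alpha> \<beta>))
    = 0"
    unfolding y_def[symmetric] jet
    by (rule harmonic_equation_on_solution[where h = h and X = X, OF inv sym x2])
qed

end
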